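(* For any integer $n\ge2$, there exists an uncountable family of Hadamard unitaries $\{u_\lambda\}_{\lambda\in I}$ in $\mathbb{M}_n$ such that: (i) $u_\lambda\sim_{\mathrm h}\mathsf{F}_n$ for all $\lambda\in I$; (ii) $u_\lambda\not\sim\mathsf{F}_n$ for all $\lambda\in I$; (iii) $u_\lambda\not\sim u_\mu$ for all $\lambda\ne\mu$ in $I$.
   Context: $\mathbb{M}_n$ is the algebra of $n\times n$ complex matrices. A Hadamard unitary is a unitary matrix in $\mathbb{M}_n$ all of whose entries have modulus $n^{-1/2}$. $\mathsf{F}_n=\frac1{\sqrt n}(\omega^{jk})_{0\le j,k\le n-1}$, $\omega=e^{2\pi i/n}$, is the Fourier matrix. Hadamard equivalence: $u\sim_{\mathrm h}v$ if there exist permutation matrices $P_1,P_2$ and diagonal unitary matrices $D_1,D_2$ with $v=D_1P_1uP_2D_2$. Bakshi–Guin equivalence: $u\sim v$ if there exist a permutation matrix $P$ and a diagonal unitary matrix $D$ with $v=uPD$. *)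

theory Defs
  imports
    "Jordan_Normal_Form.Schur_Decomposition"
    "HOL-Combinatorics.Permutations"
    "HOL-Library.Countable_Set"
    Complex_Main
begin

definition unitary_mat :: "nat \<Rightarrow> complex mat \<Rightarrow> bool" where
  "unitary_mat n U \<longleftrightarrow>
     U \<in> carrier_mat n n \<and> mat_adjoint U * U = 1\<^sub>m n \<and> U * mat_adjoint U = 1\<^sub>m n"

definition hadamard_unitary :: "nat \<Rightarrow> complex mat \<Rightarrow> bool" where
  "hadamard_unitary n U \<longleftrightarrow>
     unitary_mat n U \<and> (\<forall>i<n. \<forall>j<n. cmod (U $$ (i, j)) = 1 / sqrt (real n))"

definition permutation_mat :: "nat \<Rightarrow> complex mat \<Rightarrow> bool" where
  "permutation_mat n P \<longleftrightarrow>
     (\<exists>\<pi>. \<pi> permutes {..<n} \<and> P = mat n n (\<lambda>(i, j). if i = \<pi> j then 1 else 0))"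

definition diagonal_unitary_mat :: "nat \<Rightarrow> complex mat \<Rightarrow> bool" where
  "diagonal_unitary_mat n D \<longleftrightarrow> diagonal_mat D \<and> unitary_mat n D"

definition fourier_mat :: "nat \<Rightarrow> complex mat" where
  "fourier_mat n =
     mat n n (\<lambda>(j, k). 1 / complex_of_real (sqrt (real n)) *
                        exp (2 * complex_of_real pi * \<i> / of_nat n) ^ (j * k))"

text \<open>The two equivalence relations are meant for \<open>u\<close> and \<open>v\<close> in \<^term>\<open>carrier_mat n n\<close>.\<close>

definition hadamard_equiv :: "nat \<Rightarrow> complex mat \<Rightarrow> complex mat \<Rightarrow> bool" where
  "hadamard_equiv n u v \<longleftrightarrow>
     (\<exists>D\<^sub>1 P\<^sub>1 P\<^sub>2 D\<^sub>2. permutation_mat n P\<^sub>1 \<and> permutation_mat n P\<^sub>2 \<and>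
        diagonal_unitary_mat n D\<^sub>1 \<and> diagonal_unitary_mat n D\<^sub>2 \<and>
        v = D\<^sub>1 * P\<^sub>1 * u * P\<^sub>2 * D\<^sub>2)"

definition bakshi_guin_equiv :: "nat \<Rightarrow> complex mat \<Rightarrow> complex mat \<Rightarrow> bool" where
  "bakshi_guin_equiv n u v \<longleftrightarrow>
     (\<exists>P D. permutation_mat n P \<and> diagonal_unitary_mat n D \<and> v = u * P * D)"

end

theory Submission
  imports Defs "HOL-Analysis.Continuum_Not_Denumerable"
begin

text \<open>
  Multiplying a single row of the Fourier matrix by a phase gives a continuum of matrices that
  Bakshi--Guin equivalence tells apart.  Right multiplication by a permutation matrix and a diagonal
  matrix only permutes and rescales columns, so if \<open>u \<sim> v\<close>, then every ratio between the entries in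
  rows \<open>0\<close> and \<open>1\<close> of a column of \<open>v\<close> is also such a ratio for \<open>u\<close>
  (\<open>bakshi_guin_equivD\<close>).  For the Fourier matrix these ratios are
  \<open>n\<close>-th roots of unity.  After row \<open>0\<close> is multiplied by \<open>cis (t / n)\<close>, all of them have \<open>n\<close>-th
  power \<open>cis t\<close>, whichever column is taken.  Hence \<open>cis t\<close> is an invariant of the equivalence
  class (\<open>phase_fourier_equivD\<close>), and it determines \<open>t\<close> in \<open>[0, \<pi>]\<close>.  The Fourier matrix is the
  member of the family at \<open>t = 0\<close>, so this one invariant separates the members with \<open>0 < t < \<pi>\<close>
  both from the Fourier matrix and from each other.

  Hadamard equivalence also allows diagonal unitaries on the left, so it does not see
  the row phase.
\<close>

section \<open>Unitary matrices\<close>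

lemma unitary_mat_iff_orthonormal_columns:
  assumes A: "A \<in> carrier_mat n n"
  shows "unitary_mat n A \<longleftrightarrow>
    (\<forall>j<n. \<forall>k<n. (\<Sum>i<n. cnj (A $$ (i, j)) * A $$ (i, k)) = (if j = k then 1 else 0))"
    (is "_ \<longleftrightarrow> ?orth")
proof -
  have adj: "mat_adjoint A \<in> carrier_mat n n"
    using A unfolding mat_adjoint_def by auto
  have entry: "(mat_adjoint A * A) $$ (j, k) = (\<Sum>i<n. cnj (A $$ (i, j)) * A $$ (i, k))"
    if "j < n" "k < n" for j k
    using A that unfolding mat_adjoint_def
    by (simp add: scalar_prod_def mat_of_rows_def lessThan_atLeast0)
  have "unitary_mat n A \<longleftrightarrow> mat_adjoint A * A = 1\<^sub>m n"
    unfolding unitary_mat_def using A mat_mult_left_right_inverse[OF adj A] by blast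
  also have "\<dots> \<longleftrightarrow> ?orth"
  proof
    assume "mat_adjoint A * A = 1\<^sub>m n"
    then show ?orth using entry by (metis index_one_mat(1))
  next
    assume ?orth
    then show "mat_adjoint A * A = 1\<^sub>m n"
      using A adj by (intro eq_matI) (auto simp: entry simp del: index_mult_mat(1))
  qed
  finally show ?thesis .
qed

lemma diagonal_unitary_mat_diag:
  assumes "\<And>i. i < n \<Longrightarrow> cmod (f i) = 1"
  shows "diagonal_unitary_mat n (mat_diag n f)"
proof -
  have "(\<Sum>i<n. cnj (mat_diag n f $$ (i, j)) * mat_diag n f $$ (i, k)) = (if j = k then 1 else 0)"
    if "j < n" "k < n" for j k
  proof -
    have "(\<Sum>i<n. cnj (mat_diag n f $$ (i, j)) * mat_diag n f $$ (i, k))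
      = (\<Sum>i<n. if i = j then (if j = k then cnj (f j) * f j else 0) else 0)"
      using that by (intro sum.cong) (auto simp: mat_diag_def)
    also have "\<dots> = (if j = k then cnj (f j) * f j else 0)"
      using that by simp
    also have "cnj (f j) * f j = 1"
      using assms[OF that(1)] by (metis complex_norm_square mult.commute of_real_1 one_power2)
    finally show ?thesis .
  qed
  then show ?thesis
    unfolding diagonal_unitary_mat_def
    by (simp add: unitary_mat_iff_orthonormal_columns) (simp add: diagonal_mat_def mat_diag_def)
qed

lemma permutation_mat_one: "permutation_mat n (1\<^sub>m n)"
  unfolding permutation_mat_def
  by (intro exI[of _ id]) (auto simp: permutes_id intro!: eq_matI)

section \<open>Column scaling and Bakshi--Guin equivalence\<close>

text \<open>
  Nonzero column scalars \<open>d k\<close> cancel in the ratio of two entries of the same column, so such ratios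
  are merely permuted along with the columns.
\<close>

lemma bakshi_guin_equivD:
  assumes "bakshi_guin_equiv n u v" and u: "u \<in> carrier_mat n n"
  obtains p d where "p permutes {..<n}" "\<And>k. k < n \<Longrightarrow> d k \<noteq> 0"
    "\<And>i k. i < n \<Longrightarrow> k < n \<Longrightarrow> v $$ (i, k) = u $$ (i, p k) * d k"
proof -
  obtain P D where P: "permutation_mat n P" and D: "diagonal_unitary_mat n D"
    and v: "v = u * P * D"
    using assms unfolding bakshi_guin_equiv_def by blast
  obtain p where p: "p permutes {..<n}"
    and Pp: "P = mat n n (\<lambda>(i, j). if i = p j then 1 else 0)"
    using P unfolding permutation_mat_def by blast
  have Dc: "D \<in> carrier_mat n n" and Du: "unitary_mat n D"
    using D unfolding diagonal_unitary_mat_def unitary_mat_def by auto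
  have off: "D $$ (i, k) = 0" if "i < n" "k < n" "i \<noteq> k" for i k
    using D Dc that unfolding diagonal_unitary_mat_def diagonal_mat_def by auto
  have D_eq: "D = mat_diag n (\<lambda>k. D $$ (k, k))"
    using Dc off by (intro eq_matI) (auto simp: mat_diag_def)
  have nz: "D $$ (k, k) \<noteq> 0" if "k < n" for k
  proof
    assume "D $$ (k, k) = 0"
    then have "D $$ (i, k) = 0" if "i < n" for i
      using off[of i k] that \<open>k < n\<close> by (cases "i = k") auto
    then have "(\<Sum>i<n. cnj (D $$ (i, k)) * D $$ (i, k)) = 0" by simp
    then show False
      using Du that unfolding unitary_mat_iff_orthonormal_columns[OF Dc] by auto
  qed
  have uP: "(u * P) $$ (i, k) = u $$ (i, p k)" if "i < n" "k < n" for i k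
  proof -
    have pk: "p k < n" using permutes_in_image[OF p, of k] that by simp
    have "(u * P) $$ (i, k) = (\<Sum>l<n. u $$ (i, l) * (if l = p k then 1 else 0))"
      using u that unfolding Pp by (simp add: scalar_prod_def lessThan_atLeast0)
    also have "\<dots> = (\<Sum>l<n. if l = p k then u $$ (i, p k) else 0)"
      by (rule sum.cong) auto
    finally show ?thesis using pk by simp
  qed
  have uPc: "u * P \<in> carrier_mat n n"
    using u unfolding Pp by auto
  have v_entry: "v $$ (i, k) = u $$ (i, p k) * D $$ (k, k)" if "i < n" "k < n" for i k
    unfolding v using that
    by (subst D_eq, subst mat_diag_mult_right[OF uPc]) (simp add: uP)
  show ?thesis
    by (rule that[of p "\<lambda>k. D $$ (k, k)"]) (fact p nz v_entry)+
qed

section \<open>The Fourier matrix with a phase on one row\<close>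

text \<open>
  Dividing the angle by \<open>n\<close> makes the \<open>n\<close>-th power of the phase \<open>cis t\<close>, whose
  injectivity on \<open>[0, \<pi>]\<close> does not depend on \<open>n\<close>.
\<close>

definition row_phase :: "nat \<Rightarrow> real \<Rightarrow> complex mat" where
  "row_phase n t = mat_diag n (\<lambda>i. if i = 0 then cis (t / real n) else 1)"

definition phase_fourier :: "nat \<Rightarrow> real \<Rightarrow> complex mat" where
  "phase_fourier n t = row_phase n t * fourier_mat n"

lemma diagonal_unitary_row_phase: "diagonal_unitary_mat n (row_phase n t)"
  unfolding row_phase_def by (rule diagonal_unitary_mat_diag) simp

lemma fourier_mat_carrier [simp]: "fourier_mat n \<in> carrier_mat n n"
  by (simp add: fourier_mat_def)

lemma row_phase_carrier [simp]: "row_phase n t \<in> carrier_mat n n"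
  by (simp add: row_phase_def)

lemma phase_fourier_carrier [simp]: "phase_fourier n t \<in> carrier_mat n n"
  unfolding phase_fourier_def by (rule mult_carrier_mat[OF row_phase_carrier fourier_mat_carrier])

lemma fourier_mat_entry:
  assumes "j < n" "k < n"
  shows "fourier_mat n $$ (j, k) = cis (2 * pi * real k / real n) ^ j / of_real (sqrt (real n))"
proof -
  have "exp (2 * complex_of_real pi * \<i> / of_nat n) = cis (2 * pi / real n)"
    by (simp add: cis_conv_exp mult_ac)
  then show ?thesis
    using assms by (simp add: fourier_mat_def Complex.DeMoivre mult_ac)
qed

lemma phase_fourier_entry:
  assumes "j < n" "k < n"
  shows "phase_fourier n t $$ (j, k) = (if j = 0 then cis (t / real n) else 1) *
    cis (2 * pi * real k / real n) ^ j / of_real (sqrt (real n))"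
  using assms unfolding phase_fourier_def row_phase_def
  by (subst mat_diag_mult_left[of _ n n]) (auto simp: fourier_mat_entry)

lemma row_phase_zero: "row_phase n 0 = 1\<^sub>m n"
  by (simp add: row_phase_def cong: if_cong)

lemma phase_fourier_zero: "phase_fourier n 0 = fourier_mat n"
  by (simp add: phase_fourier_def row_phase_zero left_mult_one_mat[OF fourier_mat_carrier])

text \<open>
  The quotient of the two \<open>n\<close>-th roots of unity is an \<open>n\<close>-th root of unity other than \<open>1\<close> unless
  \<open>j = k\<close>, so its powers form a geometric progression that sums to zero.
\<close>

lemma sum_roots_unity_orthogonal:
  assumes "j < n" "k < n"
  shows "(\<Sum>i<n. cnj (cis (2 * pi * real j / real n) ^ i) * cis (2 * pi * real k / real n) ^ i)
    = (if j = k then of_nat n else 0)"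
proof -
  have n: "n > 0" using assms by simp
  define w where "w j = cis (2 * pi * real j / real n)" for j :: nat
  have unit: "cnj (w j) * w j = 1" for j
    by (simp add: w_def cis_cnj cis_mult)
  have root: "w j ^ n = 1" for j
    using n by (simp add: w_def Complex.DeMoivre cis_multiple_2pi)
  show ?thesis
  proof (cases "j = k")
    case True
    have "cnj (w k ^ i) * w k ^ i = 1" for i
      by (simp add: unit flip: power_mult_distrib)
    then show ?thesis
      using True by (simp only: w_def[symmetric]) simp
  next
    case False
    have "w j \<noteq> w k"
      using bij_betw_roots_unity[OF n] False assms
      unfolding bij_betw_def inj_on_def w_def by auto
    then have ne: "cnj (w j) * w k \<noteq> 1"
      using unit[of j] by (metis mult_cancel_left mult_zero_left zero_neq_one)
    have "(cnj (w j) * w k) ^ n = 1"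
      by (simp add: power_mult_distrib root flip: complex_cnj_power)
    then have "(\<Sum>i<n. (cnj (w j) * w k) ^ i) = 0"
      using ne by (simp add: geometric_sum)
    then show ?thesis
      using False by (simp add: power_mult_distrib flip: w_def)
  qed
qed

lemma hadamard_unitary_phase_fourier: "hadamard_unitary n (phase_fourier n t)"
proof -
  have "(\<Sum>i<n. cnj (phase_fourier n t $$ (i, j)) * phase_fourier n t $$ (i, k))
      = (if j = k then 1 else 0)" if "j < n" "k < n" for j k
  proof -
    have phase: "cnj (cis x) * cis x = 1" for x
      by (simp add: cis_cnj cis_mult)
    have sq: "complex_of_real (sqrt (real n)) * complex_of_real (sqrt (real n)) = of_nat n"
      by (simp flip: of_real_mult)
    have "(\<Sum>i<n. cnj (phase_fourier n t $$ (i, j)) * phase_fourier n t $$ (i, k))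
      = (\<Sum>i<n. cnj (cis (2 * pi * real j / real n) ^ i) * cis (2 * pi * real k / real n) ^ i
          / of_nat n)"
      using that by (intro sum.cong) (auto simp: phase_fourier_entry phase sq)
    also have "\<dots> = (if j = k then 1 else 0)"
      using that unfolding sum_divide_distrib[symmetric]
      by (subst sum_roots_unity_orthogonal) auto
    finally show ?thesis .
  qed
  then have "unitary_mat n (phase_fourier n t)"
    by (simp add: unitary_mat_iff_orthonormal_columns)
  then show ?thesis
    unfolding hadamard_unitary_def
    by (auto simp: phase_fourier_entry norm_mult norm_divide norm_power)
qed

lemma hadamard_equiv_phase_fourier: "hadamard_equiv n (phase_fourier n t) (fourier_mat n)"
proof -
  have inv: "row_phase n (- t) * row_phase n t = 1\<^sub>m n"
    unfolding row_phase_def mat_diag_diag mat_diag_one[symmetric]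
    by (rule arg_cong[where f = "mat_diag n"]) (auto simp: cis_mult)
  have "row_phase n (- t) * 1\<^sub>m n * phase_fourier n t * 1\<^sub>m n * row_phase n 0
      = row_phase n (- t) * phase_fourier n t"
    using right_mult_one_mat[OF row_phase_carrier[of n "- t"]]
      right_mult_one_mat[OF mult_carrier_mat[OF row_phase_carrier[of n "- t"]
        phase_fourier_carrier[of n t]]]
    by (simp add: row_phase_zero)
  also have "\<dots> = fourier_mat n"
    unfolding phase_fourier_def
    by (subst assoc_mult_mat[symmetric, where ?n\<^sub>1.0 = n and ?n\<^sub>2.0 = n and ?n\<^sub>3.0 = n
          and ?n\<^sub>4.0 = n]) (auto simp: inv left_mult_one_mat[OF fourier_mat_carrier])
  finally show ?thesis
    unfolding hadamard_equiv_def
    using permutation_mat_one diagonal_unitary_row_phase by metis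
qed

text \<open>
  The ratio of the first two entries in column \<open>k\<close> is \<open>cis (t / n)\<close> times an \<open>n\<close>-th root of unity;
  taking the \<open>n\<close>-th power removes the dependence on \<open>k\<close>, and with it the unknown column permutation.
\<close>

lemma phase_fourier_ratio_power:
  assumes "n \<ge> 2" "k < n"
  shows "(phase_fourier n t $$ (0, k) / phase_fourier n t $$ (1, k)) ^ n = cis t"
  using assms
  by (simp add: phase_fourier_entry power_divide Complex.DeMoivre cis_multiple_2pi)

lemma phase_fourier_equivD:
  assumes n: "n \<ge> 2" and "bakshi_guin_equiv n (phase_fourier n s) (phase_fourier n t)"
  shows "cis s = cis t"
proof -
  obtain p d where p: "p permutes {..<n}" and d: "\<And>k. k < n \<Longrightarrow> d k \<noteq> 0"
    and eq: "\<And>i k. i < n \<Longrightarrow> k < n \<Longrightarrow>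
      phase_fourier n t $$ (i, k) = phase_fourier n s $$ (i, p k) * d k"
    using bakshi_guin_equivD[OF assms(2) phase_fourier_carrier] by metis
  have p0: "p 0 < n" using permutes_in_image[OF p, of 0] n by simp
  have "cis t = (phase_fourier n t $$ (0, 0) / phase_fourier n t $$ (1, 0)) ^ n"
    using n by (subst phase_fourier_ratio_power) auto
  also have "\<dots> = (phase_fourier n s $$ (0, p 0) / phase_fourier n s $$ (1, p 0)) ^ n"
    using n d[of 0] eq[of 0 0] eq[of 1 0] by simp
  also have "\<dots> = cis s"
    using n p0 by (rule phase_fourier_ratio_power)
  finally show ?thesis ..
qed

lemma cis_inj_on_upper_half: "inj_on cis {0..pi}"
proof (rule inj_onI)
  fix s t :: real
  assume st: "s \<in> {0..pi}" "t \<in> {0..pi}" and "cis s = cis t"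
  then have "Re (cis s) = Re (cis t)" by simp
  then show "s = t"
    using cos_inj_pi[of s t] st by simp
qed

theorem lemma3p23:
  fixes n :: nat
  assumes "n \<ge> 2"
  shows "\<exists>(I :: real set) (u :: real \<Rightarrow> complex mat).
    uncountable I \<and>
    (\<forall>l\<in>I. hadamard_unitary n (u l)) \<and>
    (\<forall>l\<in>I. hadamard_equiv n (u l) (fourier_mat n)) \<and>
    (\<forall>l\<in>I. \<not> bakshi_guin_equiv n (u l) (fourier_mat n)) \<and>
    (\<forall>l\<in>I. \<forall>m\<in>I. l \<noteq> m \<longrightarrow> \<not> bakshi_guin_equiv n (u l) (u m))"
proof (intro exI conjI ballI impI)
  have separated: "\<not> bakshi_guin_equiv n (phase_fourier n s) (phase_fourier n t)"
    if "s \<in> {0..pi}" "t \<in> {0..pi}" "s \<noteq> t" for s t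
    using phase_fourier_equivD[OF assms] inj_onD[OF cis_inj_on_upper_half] that by blast
  show "uncountable {0<..<pi}"
    by (simp add: uncountable_open_interval)
  show "hadamard_unitary n (phase_fourier n l)" for l
    by (rule hadamard_unitary_phase_fourier)
  show "hadamard_equiv n (phase_fourier n l) (fourier_mat n)" for l
    by (rule hadamard_equiv_phase_fourier)
  show "\<not> bakshi_guin_equiv n (phase_fourier n l) (fourier_mat n)" if "l \<in> {0<..<pi}" for l
    using separated[of l 0] that by (simp add: phase_fourier_zero)
  show "\<not> bakshi_guin_equiv n (phase_fourier n l) (phase_fourier n m)"
    if "l \<in> {0<..<pi}" "m \<in> {0<..<pi}" "l \<noteq> m" for l m
    using separated[of l m] that by simp
qed

end
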